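(* Suppose that $\alpha_{i_0}>0$. Then there exists $N>0$ such that for every $a\in\mathbb{R}$ with $|a|>N$ and $f_a^{(m_{i_0})}(\alpha_{i_0})>0$, the set $$\Lambda_a=\{x\in\mathbb{R}:\ f_a^k(x)\in[\alpha_{i_0},\alpha_{i_0+1}]\ \text{for all}\ k\ge 0\}$$ is an invariant Cantor set for $f_a$, $f_a$ is hyperbolic on $\Lambda_a$, and $f_a:\Lambda_a\to\Lambda_a$ is topologically conjugate to $\sigma:\Sigma_2\to\Sigma_2$.
   Context: Let $g(x)=x^n+a_{n-1}x^{n-1}+\cdots+a_0$ be a real-coefficient polynomial whose distinct real zeros are $\alpha_1<\cdots<\alpha_r$ with $r\ge 2$, where $\alpha_i$ has multiplicity $m_i\ge 1$. Fix an index $i_0$ with $1\le i_0<r$. For a real parameter $a$ let $f_a(x)=a g(x)$; $f_a^k$ denotes the $k$-fold iterate of $f_a$, and $f_a^{(m)}$ the $m$-th derivative. A set $\Lambda$ is invariant for $f$ if $f(\Lambda)=\Lambda$. For a $C^1$ map $f:\mathbb{R}\to\mathbb{R}$, a compact invariant set $\Lambda$ is a hyperbolic set for $f$ (equivalently, $f$ is hyperbolic on $\Lambda$) if there are constants $C>0$ and $\lambda>1$ such that $|(f^n)'(x)|\ge C\lambda^n$ for all $x\in\Lambda$ and all $n\ge1$. $\Sigma_2=\{(s_0,s_1,s_2,\dots): s_i\in\{1,2\}\}$ is the one-sided sequence space on two symbols with the metric $d(s,t)=\sum_{i\ge0}\delta(s_i,t_i)/2^i$ ($\delta(s_i,t_i)=1$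 if $s_i\ne t_i$ and $0$ otherwise), and $\sigma(s_0,s_1,s_2,\dots)=(s_1,s_2,\dots)$ is the shift map. *)

theory Defs
  imports "HOL-Analysis.Analysis" "HOL-Computational_Algebra.Polynomial"
begin

definition fam :: "real poly \<Rightarrow> real \<Rightarrow> real \<Rightarrow> real"
  where "fam g a x = a * poly g x"

definition Lam :: "(real \<Rightarrow> real) \<Rightarrow> real set \<Rightarrow> real set"
  where "Lam f I = {x. \<forall>k. (f ^^ k) x \<in> I}"

definition invariant_set :: "('a \<Rightarrow> 'a) \<Rightarrow> 'a set \<Rightarrow> bool"
  where "invariant_set f S \<longleftrightarrow> f ` S = S"

definition cantor_set :: "real set \<Rightarrow> bool"
  where "cantor_set S \<longleftrightarrow>
    S \<noteq> {} \<and> compact S \<and>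
    (\<forall>x\<in>S. x islimpt S) \<and>
    (\<forall>x\<in>S. connected_component_set S x = {x})"

text \<open>The first two conjuncts say that the map is of class C1 on the real line.\<close>

definition hyperbolic_on :: "(real \<Rightarrow> real) \<Rightarrow> real set \<Rightarrow> bool"
  where "hyperbolic_on f S \<longleftrightarrow>
    (\<forall>x. f differentiable (at x)) \<and> continuous_on UNIV (deriv f) \<and>
    compact S \<and> invariant_set f S \<and>
    (\<exists>C>0. \<exists>l>1. \<forall>x\<in>S. \<forall>n\<ge>1. \<bar>deriv (f ^^ n) x\<bar> \<ge> C * l ^ n)"

definition Sigma2 :: "(nat \<Rightarrow> nat) set"
  where "Sigma2 = {s. \<forall>i. s i \<in> {1, 2}}"

definition dist2 :: "(nat \<Rightarrow> nat) \<Rightarrow> (nat \<Rightarrow> nat) \<Rightarrow> real"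
  where "dist2 s t = (\<Sum>i. (if s i \<noteq> t i then 1 else 0) / 2 ^ i)"

definition shift :: "(nat \<Rightarrow> nat) \<Rightarrow> (nat \<Rightarrow> nat)"
  where "shift s = (\<lambda>i. s (Suc i))"

lemma summable_dist2: "summable (\<lambda>i. (if s i \<noteq> t i then 1 else 0) / 2 ^ i :: real)"
proof (rule summable_comparison_test'[where N = 0])
  show "summable (\<lambda>i. (1/2) ^ i :: real)"
    by (rule summable_geometric) simp
qed (auto simp: power_one_over)

lemma Metric_space_Sigma2: "Metric_space Sigma2 dist2"
proof
  fix s t u :: "nat \<Rightarrow> nat"
  show "0 \<le> dist2 s t"
    unfolding dist2_def by (intro suminf_nonneg summable_dist2) auto
  show "dist2 s t = dist2 t s"
    unfolding dist2_def by (simp add: eq_commute)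
  show "dist2 s t = 0 \<longleftrightarrow> s = t"
    unfolding dist2_def by (subst suminf_eq_zero_iff[OF summable_dist2]) (auto simp: fun_eq_iff)
  show "dist2 s u \<le> dist2 s t + dist2 t u"
    unfolding dist2_def suminf_add[OF summable_dist2 summable_dist2]
    by (intro suminf_le summable_add summable_dist2) (auto simp: divide_simps)
qed

definition topologically_conjugate ::
    "'a topology \<Rightarrow> ('a \<Rightarrow> 'a) \<Rightarrow> 'b topology \<Rightarrow> ('b \<Rightarrow> 'b) \<Rightarrow> bool"
  where "topologically_conjugate X f Y g \<longleftrightarrow>
    continuous_map X X f \<and> continuous_map Y Y g \<and>
    (\<exists>h. homeomorphic_map X Y h \<and> (\<forall>x\<in>topspace X. h (f x) = g (h x)))"

end

theory Submission
  imports Defs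
begin

text \<open>
  Write \<open>p < q\<close> for the two consecutive roots, \<open>I = {p..q}\<close> and \<open>f = a g\<close>. The sign of the
  derivative of order \<open>m\<close> at \<open>p\<close> says exactly that \<open>f\<close> is positive on the open interval
  (\<open>fam_pos_right_of_root\<close>). For large \<open>\<bar>a\<bar>\<close> the graph rises above \<open>q\<close> away from the two roots, so the
  points of \<open>I\<close> that stay in \<open>I\<close> under \<open>f\<close> form one piece near \<open>p\<close> and one piece near \<open>q\<close>.

  The roots may be multiple, so \<open>f'\<close> may vanish at \<open>p\<close> and \<open>q\<close>, and expansion cannot come from a
  lower bound on \<open>\<bar>g'\<bar>\<close>. It comes from the identity \<open>f' = f \<cdot> (g'/g)\<close>, in which the second factor does not
  depend on \<open>a\<close>. The logarithmic derivative \<open>g'/g\<close> behaves like \<open>m / (x - z)\<close> at a root \<open>z\<close> of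
  multiplicity \<open>m\<close> (\<open>log_derivative_near_root\<close>), hence is at least \<open>2 / p\<close> in absolute value on fixed
  neighbourhoods of \<open>p\<close> and \<open>q\<close>. Where moreover \<open>f x \<ge> p\<close>, this gives \<open>\<bar>f' x\<bar> \<ge> 2\<close>. This is where
  \<open>p > 0\<close> enters: a return to \<open>I\<close> keeps \<open>f\<close> away from \<open>0\<close>.

  What remains is a unimodal map that expands by the factor \<open>2\<close> wherever it returns to \<open>I\<close>
  (\<open>unimodal_horseshoe\<close>). By the chain rule the derivatives of its iterates grow at least like \<open>2 ^ n\<close>. Each of
  the two pieces is mapped bijectively onto \<open>I\<close>, so every itinerary in \<open>Sigma2\<close> is realized by a
  nested sequence of compact sets, and by only one point because two orbits in the same pieces double
  their distance at each step. The itinerary map is therefore a continuous bijection from a compact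
  space to a Hausdorff space, hence a homeomorphism, and it turns \<open>f\<close> into the shift. Changing one late
  symbol gives nearby points, so the invariant set is perfect; two points with different itineraries are
  separated by the preimages of the two pieces under some iterate, so it is totally disconnected.
\<close>

section \<open>The shift metric\<close>

text \<open>The first symbol has weight \<open>1\<close> and every other weight is halved by the shift. This recurrence
  gives both the Lipschitz bound for the shift and, by induction, the size of cylinder sets.\<close>

lemma dist2_split: "dist2 s t = (if s 0 \<noteq> t 0 then 1 else 0) + dist2 (shift s) (shift t) / 2"
proof -
  let ?d = "\<lambda>i. (if s i \<noteq> t i then 1 else 0) / 2 ^ i :: real"
  have "(\<Sum>i. ?d (Suc i)) = (\<Sum>i. (if shift s i \<noteq> shift t i then 1 else 0) / 2 ^ i / 2)"
    by (rule arg_cong[where f = suminf]) (auto simp: shift_def)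
  also have "\<dots> = dist2 (shift s) (shift t) / 2"
    unfolding dist2_def by (rule suminf_divide[OF summable_dist2])
  finally show ?thesis
    using suminf_split_head[OF summable_dist2[of s t]] by (simp add: dist2_def)
qed

lemma dist2_le_2: "dist2 s t \<le> 2"
proof -
  have "dist2 s t \<le> (\<Sum>i. (1/2) ^ i)"
    unfolding dist2_def
    by (intro suminf_le summable_dist2 summable_geometric) (auto simp: power_one_over)
  then show ?thesis by (simp add: suminf_geometric)
qed

lemma dist2_le_agree:
  assumes "\<forall>i<n. s i = t i"
  shows "dist2 s t \<le> 2 / 2 ^ n"
  using assms
proof (induction n arbitrary: s t)
  case 0
  then show ?case using dist2_le_2 by simp
next
  case (Suc n)
  have "dist2 (shift s) (shift t) \<le> 2 / 2 ^ n"
    using Suc by (auto simp: shift_def)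
  then show ?case
    using Suc.prems dist2_split[of s t] by simp
qed

interpretation Sigma2: Metric_space Sigma2 dist2
  by (rule Metric_space_Sigma2)

lemma shift_in_Sigma2: "s \<in> Sigma2 \<Longrightarrow> shift s \<in> Sigma2"
  by (simp add: Sigma2_def shift_def)

lemma continuous_map_shift: "continuous_map Sigma2.mtopology Sigma2.mtopology shift"
  unfolding Sigma2.continuous_map_to_metric
proof (intro ballI allI impI)
  fix s and e :: real
  assume s: "s \<in> topspace Sigma2.mtopology" and e: "e > 0"
  show "\<exists>U. openin Sigma2.mtopology U \<and> s \<in> U \<and> (\<forall>t\<in>U. shift t \<in> Sigma2.mball (shift s) e)"
  proof (intro exI conjI ballI)
    fix t assume t: "t \<in> Sigma2.mball s (e / 2)"
    then have "dist2 (shift s) (shift t) < e"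
      using dist2_split[of s t] by (auto split: if_splits)
    with t show "shift t \<in> Sigma2.mball (shift s) e"
      by (auto intro: shift_in_Sigma2)
  qed (use s e in auto)
qed

section \<open>Symbolic dynamics of two expanding branches\<close>

text \<open>The pieces are indexed by the symbols \<open>1\<close> and \<open>2\<close> themselves. The expansion assumption does two
  jobs: it makes \<open>f\<close> injective on each piece and makes cylinders shrink geometrically. Continuity on the
  whole line keeps preimages under iterates closed without restriction of domains.\<close>

locale two_branch_horseshoe =
  fixes f :: "real \<Rightarrow> real" and I :: "real set" and J :: "nat \<Rightarrow> real set"
  assumes cont: "continuous_on UNIV f"
    and compact_I: "compact I" and I_nonempty: "I \<noteq> {}"
    and closed_J: "\<And>i. i \<in> {1, 2} \<Longrightarrow> closed (J i)"
    and disjoint_J: "J 1 \<inter> J 2 = {}"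
    and union_J: "J 1 \<union> J 2 = {x \<in> I. f x \<in> I}"
    and image_J: "\<And>i. i \<in> {1, 2} \<Longrightarrow> f ` J i = I"
    and expanding: "\<And>i x y. i \<in> {1, 2} \<Longrightarrow> x \<in> J i \<Longrightarrow> y \<in> J i \<Longrightarrow> 2 * dist x y \<le> dist (f x) (f y)"
begin

definition itinerary :: "real \<Rightarrow> nat \<Rightarrow> nat" where
  "itinerary x k = (if (f ^^ k) x \<in> J 1 then 1 else 2)"

lemma itinerary_in_Sigma2: "itinerary x \<in> Sigma2"
  by (simp add: Sigma2_def itinerary_def)

lemma itinerary_cases: "itinerary x k \<in> {1, 2}"
  by (simp add: itinerary_def)

lemma J_subset:
  assumes "i \<in> {1, 2}"
  shows "J i \<subseteq> I"
proof -
  have "J i \<subseteq> J 1 \<union> J 2" using assms by blast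
  then show ?thesis unfolding union_J by blast
qed

lemma iterate_in_union:
  assumes "x \<in> Lam f I"
  shows "(f ^^ k) x \<in> J 1 \<union> J 2"
proof -
  have "(f ^^ k) x \<in> I" "(f ^^ Suc k) x \<in> I"
    using assms unfolding Lam_def by blast+
  then show ?thesis unfolding union_J by simp
qed

lemma iterate_in_itinerary:
  assumes "x \<in> Lam f I"
  shows "(f ^^ k) x \<in> J (itinerary x k)"
  using iterate_in_union[OF assms, of k] by (auto simp: itinerary_def)

lemma itinerary_eqI:
  assumes "(f ^^ k) x \<in> J i" "i \<in> {1, 2}"
  shows "itinerary x k = i"
  using assms disjoint_J by (auto simp: itinerary_def)

lemma itinerary_apply: "itinerary (f x) = shift (itinerary x)"
  by (rule ext) (simp add: itinerary_def shift_def funpow_swap1)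

lemma Lam_subset: "Lam f I \<subseteq> I"
proof
  fix x assume "x \<in> Lam f I"
  then have "(f ^^ 0) x \<in> I" unfolding Lam_def by blast
  then show "x \<in> I" by simp
qed

text \<open>Surjectivity holds because each piece alone already covers \<open>I\<close>; the preimage is taken
  in \<open>J 1\<close>.\<close>

lemma image_Lam: "f ` Lam f I = Lam f I"
proof (intro equalityI subsetI)
  fix y assume "y \<in> f ` Lam f I"
  then obtain x where y: "y = f x" and x: "x \<in> Lam f I" by blast
  have "(f ^^ k) y \<in> I" for k
  proof -
    have "(f ^^ Suc k) x \<in> I" using x unfolding Lam_def by blast
    then show ?thesis by (simp add: y funpow_swap1)
  qed
  then show "y \<in> Lam f I" by (simp add: Lam_def)
next
  fix y assume y: "y \<in> Lam f I"
  have "y \<in> f ` J 1" using Lam_subset y image_J[of 1] by auto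
  then obtain x where x: "x \<in> J 1" "y = f x" by blast
  have "(f ^^ k) x \<in> I" for k
  proof (cases k)
    case 0
    then show ?thesis using x union_J by auto
  next
    case (Suc n)
    then show ?thesis using y x(2) by (simp add: Lam_def funpow_swap1)
  qed
  then show "y \<in> f ` Lam f I" using x(2) by (auto simp: Lam_def)
qed

lemma continuous_on_iterate: "continuous_on UNIV (f ^^ k)"
proof (induction k)
  case (Suc k)
  then show ?case
    using continuous_on_compose2[OF cont Suc] by (simp add: o_def)
qed (simp add: id_def)

lemma closed_iterate_vimage: "closed S \<Longrightarrow> closed ((f ^^ k) -` S)"
  using continuous_on_iterate by (simp add: continuous_on_closed_vimage)

lemma compact_Lam: "compact (Lam f I)"
proof -
  have "Lam f I = I \<inter> (\<Inter>k. (f ^^ k) -` I)"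
    using Lam_subset by (auto simp: Lam_def)
  moreover have "closed (\<Inter>k. (f ^^ k) -` I)"
    using closed_iterate_vimage compact_I compact_imp_closed by blast
  ultimately show ?thesis
    using compact_I by (simp add: compact_Int_closed)
qed

text \<open>As long as two orbits visit the same pieces, each step at least doubles their distance.\<close>

lemma orbit_separation:
  assumes "x \<in> Lam f I" "y \<in> Lam f I" "\<forall>k<n. itinerary x k = itinerary y k"
  shows "2 ^ n * dist x y \<le> dist ((f ^^ n) x) ((f ^^ n) y)"
  using assms(3)
proof (induction n)
  case (Suc n)
  have "2 * dist ((f ^^ n) x) ((f ^^ n) y) \<le> dist (f ((f ^^ n) x)) (f ((f ^^ n) y))"
    using expanding[OF itinerary_cases iterate_in_itinerary[OF assms(1), of n]]
      iterate_in_itinerary[OF assms(2), of n] Suc.prems by simp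
  then show ?case using Suc by simp
qed simp

lemma dist_le_agree:
  assumes "x \<in> Lam f I" "y \<in> Lam f I" "\<forall>k<n. itinerary x k = itinerary y k"
  shows "dist x y \<le> diameter I / 2 ^ n"
proof -
  have "(f ^^ n) x \<in> I" "(f ^^ n) y \<in> I" using assms by (auto simp: Lam_def)
  then have "dist ((f ^^ n) x) ((f ^^ n) y) \<le> diameter I"
    using diameter_bounded_bound compact_imp_bounded[OF compact_I] by blast
  then show ?thesis
    using orbit_separation[OF assms] by (simp add: field_simps)
qed

lemma diameter_over_power_small:
  assumes "e > 0"
  obtains n where "diameter I / 2 ^ n < e"
proof -
  have "diameter I \<ge> 0"
    using diameter_ge_0 compact_imp_bounded[OF compact_I] by blast
  moreover obtain n where "diameter I / e < 2 ^ n"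
    using real_arch_pow[of 2 "diameter I / e"] by auto
  ultimately have "diameter I / 2 ^ n < e"
    using assms by (simp add: field_simps)
  then show ?thesis by (rule that)
qed

lemma inj_on_itinerary: "inj_on itinerary (Lam f I)"
proof (rule inj_onI, rule ccontr)
  fix x y assume *: "x \<in> Lam f I" "y \<in> Lam f I" "itinerary x = itinerary y" "x \<noteq> y"
  obtain n where "diameter I / 2 ^ n < dist x y"
    using diameter_over_power_small[of "dist x y"] * by auto
  then show False using dist_le_agree[of x y n] * by simp
qed

text \<open>The end point \<open>y\<close> is kept arbitrary, so that the induction can extend the word at its end: a
  preimage of \<open>y\<close> in the last piece serves as the end point for the shorter word.\<close>

lemma finite_itinerary_realized:
  assumes "s \<in> Sigma2" "y \<in> I"
  shows "\<exists>x. (f ^^ n) x = y \<and> (\<forall>k<n. (f ^^ k) x \<in> J (s k))"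
  using assms(2)
proof (induction n arbitrary: y)
  case (Suc n)
  have sn: "s n \<in> {1, 2}" using assms(1) by (simp add: Sigma2_def)
  then obtain z where z: "z \<in> J (s n)" "f z = y"
    using image_J[OF sn] Suc.prems by blast
  have "z \<in> I" using z(1) J_subset[OF sn] by blast
  then obtain x where "(f ^^ n) x = z" "\<forall>k<n. (f ^^ k) x \<in> J (s k)"
    using Suc.IH by blast
  then show ?case using z by (auto simp: less_Suc_eq)
qed simp

text \<open>Points with the first \<open>n\<close> symbols prescribed form a decreasing sequence of nonempty compact
  sets, so some point has all symbols prescribed.\<close>

lemma itinerary_realized:
  assumes s: "s \<in> Sigma2"
  shows "\<exists>x \<in> Lam f I. itinerary x = s"
proof -
  have s12: "s k \<in> {1, 2}" for k using s by (simp add: Sigma2_def)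
  define K where "K n = I \<inter> (\<Inter>k\<in>{..n}. (f ^^ k) -` J (s k))" for n
  have "compact (K n)" for n
    unfolding K_def
    by (intro compact_Int_closed compact_I closed_INT ballI closed_iterate_vimage closed_J s12)
  moreover have "K n \<noteq> {}" for n
  proof -
    obtain y where "y \<in> I" using I_nonempty by blast
    from finite_itinerary_realized[OF s this, of "Suc n"]
    obtain x where x: "\<forall>k<Suc n. (f ^^ k) x \<in> J (s k)" by blast
    then have "(f ^^ 0) x \<in> J (s 0)" by blast
    then have "x \<in> J (s 0)" by simp
    then have "x \<in> I" using J_subset[OF s12] by blast
    then have "x \<in> K n" using x by (simp add: K_def less_Suc_eq_le)
    then show ?thesis by blast
  qed
  moreover have "K n \<subseteq> K k" if "k \<le> n" for k n
    using that by (fastforce simp: K_def)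
  ultimately have "\<Inter>(range K) \<noteq> {}" by (rule compact_nest)
  then obtain x where "\<And>n. x \<in> K n" by blast
  then have x: "(f ^^ k) x \<in> J (s k)" for k by (auto simp: K_def)
  have "(f ^^ k) x \<in> I" for k using x J_subset[OF s12] by blast
  then have "x \<in> Lam f I" by (simp add: Lam_def)
  moreover have "itinerary x = s" using itinerary_eqI[OF x s12] by (rule ext)
  ultimately show ?thesis by blast
qed

lemma Lam_nonempty: "Lam f I \<noteq> {}"
  using itinerary_realized[OF itinerary_in_Sigma2[of undefined]] by blast

text \<open>Each symbol is locally constant on the invariant set, because the piece that an iterate misses
  is closed; so finitely many symbols agree on a neighbourhood, which bounds the shift distance.\<close>

lemma continuous_map_itinerary:
  "continuous_map (top_of_set (Lam f I)) Sigma2.mtopology itinerary"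
  unfolding Sigma2.continuous_map_to_metric
proof (intro ballI allI impI)
  fix x and e :: real
  assume "x \<in> topspace (top_of_set (Lam f I))" and e: "e > 0"
  then have x: "x \<in> Lam f I" by simp
  obtain n where "2 / e < 2 ^ n" using real_arch_pow[of 2 "2 / e"] by auto
  then have n: "2 / 2 ^ n < e" using e by (simp add: field_simps)
  \<comment> \<open>On \<open>{1, 2}\<close> the map \<open>i \<mapsto> 3 - i\<close> exchanges the symbols, so \<open>V\<close> avoids the wrong pieces.\<close>
  define V where "V = (\<Inter>k\<in>{..<n}. - ((f ^^ k) -` J (3 - itinerary x k)))"
  have "3 - itinerary x k \<in> {1, 2}" for k using itinerary_cases[of x k] by auto
  then have "open V"
    unfolding V_def
    by (intro open_INT finite_lessThan ballI open_Compl closed_iterate_vimage closed_J)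
  have agree: "y \<in> V \<longleftrightarrow> (\<forall>k<n. itinerary x k = itinerary y k)" if "y \<in> Lam f I" for y
  proof -
    have "(f ^^ k) y \<notin> J (3 - itinerary x k) \<longleftrightarrow> itinerary x k = itinerary y k" for k
      using iterate_in_union[OF that, of k] disjoint_J itinerary_cases[of x k]
      by (auto simp: itinerary_def[of y])
    then show ?thesis by (auto simp: V_def)
  qed
  show "\<exists>U. openin (top_of_set (Lam f I)) U \<and> x \<in> U
      \<and> (\<forall>y\<in>U. itinerary y \<in> Sigma2.mball (itinerary x) e)"
  proof (intro exI conjI ballI)
    show "openin (top_of_set (Lam f I)) (Lam f I \<inter> V)"
      using \<open>open V\<close> by (rule openin_open_Int)
    show "x \<in> Lam f I \<inter> V" using x agree by blast
    fix y assume "y \<in> Lam f I \<inter> V"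
    then have "dist2 (itinerary x) (itinerary y) \<le> 2 / 2 ^ n"
      using agree by (intro dist2_le_agree) blast
    then show "itinerary y \<in> Sigma2.mball (itinerary x) e"
      using n by (simp add: itinerary_in_Sigma2)
  qed
qed

lemma homeomorphic_map_itinerary:
  "homeomorphic_map (top_of_set (Lam f I)) Sigma2.mtopology itinerary"
proof (rule continuous_imp_homeomorphic_map)
  show "itinerary ` topspace (top_of_set (Lam f I)) = topspace Sigma2.mtopology"
    using itinerary_realized itinerary_in_Sigma2 by force
qed (use continuous_map_itinerary compact_Lam inj_on_itinerary Sigma2.Hausdorff_space_mtopology
      in \<open>auto simp: compact_space_subtopology\<close>)

lemma conjugate_to_shift:
  "topologically_conjugate (top_of_set (Lam f I)) f Sigma2.mtopology shift"
proof -
  have "continuous_map (top_of_set (Lam f I)) (top_of_set (Lam f I)) f"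
    using cont image_Lam by (auto intro: continuous_on_subset)
  then show ?thesis
    unfolding topologically_conjugate_def
    using continuous_map_shift homeomorphic_map_itinerary itinerary_apply by blast
qed

text \<open>The point whose itinerary differs from that of \<open>x\<close> in the single symbol \<open>n\<close> is distinct from
  \<open>x\<close> but within \<open>diameter I / 2 ^ n\<close> of it.\<close>

lemma Lam_perfect:
  assumes x: "x \<in> Lam f I"
  shows "x islimpt Lam f I"
  unfolding islimpt_approachable
proof (intro allI impI)
  fix e :: real assume "e > 0"
  then obtain n where n: "diameter I / 2 ^ n < e" by (rule diameter_over_power_small)
  define s where "s = (itinerary x)(n := 3 - itinerary x n)"
  have "3 - itinerary x n \<in> {1, 2}" using itinerary_cases[of x n] by auto
  then have "s \<in> Sigma2" using itinerary_cases[of x] by (simp add: Sigma2_def s_def)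
  then obtain y where y: "y \<in> Lam f I" "itinerary y = s" using itinerary_realized by blast
  have "itinerary y n \<noteq> itinerary x n" using itinerary_cases[of x n] y by (auto simp: s_def)
  then have "y \<noteq> x" by blast
  moreover have "dist y x < e"
    using dist_le_agree[OF y(1) x, of n] y(2) n by (simp add: s_def)
  ultimately show "\<exists>x'\<in>Lam f I. x' \<noteq> x \<and> dist x' x < e" using y(1) by blast
qed

text \<open>A connected set cannot meet the preimages of both pieces under the same iterate, so all its
  points share one itinerary.\<close>

lemma Lam_totally_disconnected:
  assumes "C \<subseteq> Lam f I" "connected C" "x \<in> C" "y \<in> C"
  shows "x = y"
proof -
  have "itinerary x k = itinerary y k" for k
  proof -
    let ?C = "\<lambda>i. (f ^^ k) -` J i"
    have "closed (?C 1)" "closed (?C 2)"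
      by (auto intro!: closed_iterate_vimage closed_J)
    moreover have "C \<subseteq> ?C 1 \<union> ?C 2" using iterate_in_union assms(1) by blast
    moreover have "?C 1 \<inter> ?C 2 \<inter> C = {}" using disjoint_J by blast
    ultimately have "?C 1 \<inter> C = {} \<or> ?C 2 \<inter> C = {}"
      using assms(2) unfolding connected_closed by blast
    then show ?thesis
      using assms(3,4) \<open>C \<subseteq> ?C 1 \<union> ?C 2\<close> disjoint_J by (auto simp: itinerary_def)
  qed
  then show ?thesis
    using inj_on_itinerary assms by (metis ext inj_onD subsetD)
qed

lemma Lam_connected_component:
  assumes "x \<in> Lam f I"
  shows "connected_component_set (Lam f I) x = {x}"
  using Lam_totally_disconnected[OF connected_component_subset connected_connected_component]
    connected_component_refl[OF assms] by blast

end

section \<open>Unimodal maps of an interval\<close>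

text \<open>Strict monotonicity keeps the values between \<open>x\<close> and \<open>y\<close> inside \<open>{p..q}\<close>, so the intermediate
  point supplied by the mean value theorem is one at which the derivative bound is available. Positivity of the
  derivative is asked only in the open interval, since an end point may be a multiple root.\<close>

lemma increasing_branch:
  fixes f f' :: "real \<Rightarrow> real"
  assumes deriv: "\<And>x. (f has_real_derivative f' x) (at x)"
    and "u \<le> v" "f u \<le> p" "q \<le> f v"
    and pos: "\<And>x. u < x \<Longrightarrow> x < v \<Longrightarrow> f' x > 0"
    and expand: "\<And>x. u \<le> x \<Longrightarrow> x \<le> v \<Longrightarrow> f x \<in> {p..q} \<Longrightarrow> 2 \<le> \<bar>f' x\<bar>"
  shows "f ` {x \<in> {u..v}. f x \<in> {p..q}} = {p..q}"
    and "\<And>x y. x \<in> {u..v} \<Longrightarrow> f x \<in> {p..q} \<Longrightarrow> y \<in> {u..v} \<Longrightarrow> f y \<in> {p..q}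
      \<Longrightarrow> 2 * dist x y \<le> dist (f x) (f y)"
proof -
  have cont: "continuous_on S f" for S
    using deriv by (meson DERIV_isCont continuous_at_imp_continuous_on)
  have mono: "f x < f y" if "u \<le> x" "x < y" "y \<le> v" for x y
  proof (rule DERIV_pos_imp_increasing_open[OF that(2) _ cont])
    fix z assume "x < z" "z < y"
    then show "\<exists>d. DERIV f z :> d \<and> d > 0" using that deriv pos[of z] by fastforce
  qed
  show "f ` {x \<in> {u..v}. f x \<in> {p..q}} = {p..q}"
  proof (intro equalityI subsetI)
    fix y assume y: "y \<in> {p..q}"
    then have "\<exists>x\<ge>u. x \<le> v \<and> f x = y"
      using assms(2-4) by (intro IVT' cont) auto
    then show "y \<in> f ` {x \<in> {u..v}. f x \<in> {p..q}}" using y by auto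
  qed auto
  have less: "2 * (y - x) \<le> f y - f x"
    if xy: "u \<le> x" "x < y" "y \<le> v" "f x \<in> {p..q}" "f y \<in> {p..q}" for x y
  proof -
    obtain z where z: "x < z" "z < y" "f y - f x = (y - x) * f' z"
      using MVT2[OF xy(2), of f f'] deriv by auto
    have "f x < f z" "f z < f y" using xy z mono by auto
    then have "2 \<le> \<bar>f' z\<bar>" using xy z by (intro expand) auto
    moreover have "f' z > 0" using xy z by (intro pos) auto
    ultimately have "2 * (y - x) \<le> f' z * (y - x)" using xy by (intro mult_right_mono) auto
    then show ?thesis using z(3) by (simp add: mult.commute)
  qed
  show "2 * dist x y \<le> dist (f x) (f y)"
    if "x \<in> {u..v}" "f x \<in> {p..q}" "y \<in> {u..v}" "f y \<in> {p..q}" for x y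
    using that less[of x y] less[of y x] by (cases x y rule: linorder_cases) (auto simp: dist_real_def)
qed

text \<open>The reflection \<open>x \<mapsto> - x\<close> reduces this to the increasing case.\<close>

lemma decreasing_branch:
  fixes f f' :: "real \<Rightarrow> real"
  assumes deriv: "\<And>x. (f has_real_derivative f' x) (at x)"
    and "u \<le> v" "q \<le> f u" "f v \<le> p"
    and neg: "\<And>x. u < x \<Longrightarrow> x < v \<Longrightarrow> f' x < 0"
    and expand: "\<And>x. u \<le> x \<Longrightarrow> x \<le> v \<Longrightarrow> f x \<in> {p..q} \<Longrightarrow> 2 \<le> \<bar>f' x\<bar>"
  shows "f ` {x \<in> {u..v}. f x \<in> {p..q}} = {p..q}"
    and "\<And>x y. x \<in> {u..v} \<Longrightarrow> f x \<in> {p..q} \<Longrightarrow> y \<in> {u..v} \<Longrightarrow> f y \<in> {p..q}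
      \<Longrightarrow> 2 * dist x y \<le> dist (f x) (f y)"
proof -
  let ?h = "\<lambda>x. f (- x)" and ?h' = "\<lambda>x. - f' (- x)"
  have dh: "(?h has_real_derivative ?h' x) (at x)" for x
    using DERIV_chain2[OF deriv DERIV_minus[OF DERIV_ident], of x] by simp
  note * = increasing_branch[of ?h ?h' "- v" "- u" p q, OF dh]
  have "?h ` {x \<in> {- v..- u}. ?h x \<in> {p..q}} = {p..q}"
    using assms(2-4) neg expand by (intro *(1)) auto
  moreover have "?h ` {x \<in> {- v..- u}. ?h x \<in> {p..q}} = f ` {x \<in> {u..v}. f x \<in> {p..q}}"
  proof (intro equalityI subsetI)
    fix y assume "y \<in> f ` {x \<in> {u..v}. f x \<in> {p..q}}"
    then obtain x where "x \<in> {u..v}" "f x \<in> {p..q}" "y = f x" by blast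
    then show "y \<in> ?h ` {x \<in> {- v..- u}. ?h x \<in> {p..q}}"
      by (intro image_eqI[where x = "- x"]) auto
  qed auto
  ultimately show "f ` {x \<in> {u..v}. f x \<in> {p..q}} = {p..q}" by metis
  show "2 * dist x y \<le> dist (f x) (f y)"
    if "x \<in> {u..v}" "f x \<in> {p..q}" "y \<in> {u..v}" "f y \<in> {p..q}" for x y
  proof -
    have "2 * dist (- x) (- y) \<le> dist (?h (- x)) (?h (- y))"
      by (rule *(2)) (use that assms(2-4) neg expand in auto)
    then show ?thesis by (simp add: dist_minus)
  qed
qed

lemma iterate_has_derivative:
  fixes f f' :: "real \<Rightarrow> real"
  assumes "\<And>x. (f has_real_derivative f' x) (at x)"
  shows "((f ^^ n) has_real_derivative (\<Prod>i<n. f' ((f ^^ i) x))) (at x)"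
proof (induction n)
  case (Suc n)
  then show ?case using DERIV_chain[OF assms Suc] by (simp add: o_def mult.commute)
qed (simp add: id_def)

text \<open>The values above \<open>q\<close> on \<open>{c..d}\<close> cut the points returning to \<open>{p..q}\<close> into a rising and a falling
  branch, which are the two pieces of a horseshoe. The same derivative bound gives expansion of distances
  on each piece and, through the chain rule, hyperbolicity with constants \<open>1\<close> and \<open>2\<close>.\<close>

lemma unimodal_horseshoe:
  fixes f f' :: "real \<Rightarrow> real"
  assumes deriv: "\<And>x. (f has_real_derivative f' x) (at x)"
    and cont': "continuous_on UNIV f'"
    and ord: "p < c" "c < d" "d < q"
    and ends: "f p \<le> p" "f q \<le> p"
    and middle: "\<And>x. c \<le> x \<Longrightarrow> x \<le> d \<Longrightarrow> q < f x"
    and pos: "\<And>x. p < x \<Longrightarrow> x < c \<Longrightarrow> f' x > 0"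
    and neg: "\<And>x. d < x \<Longrightarrow> x < q \<Longrightarrow> f' x < 0"
    and expand: "\<And>x. x \<in> {p..q} \<Longrightarrow> f x \<in> {p..q} \<Longrightarrow> 2 \<le> \<bar>f' x\<bar>"
  defines "\<Lambda> \<equiv> Lam f {p..q}"
  shows "invariant_set f \<Lambda>" and "cantor_set \<Lambda>" and "hyperbolic_on f \<Lambda>"
    and "topologically_conjugate (top_of_set \<Lambda>) f Sigma2.mtopology shift"
proof -
  define J where "J i = (if i = 1 then {x \<in> {p..c}. f x \<in> {p..q}} else {x \<in> {d..q}. f x \<in> {p..q}})"
    for i :: nat
  have cont: "continuous_on S f" for S
    using deriv by (meson DERIV_isCont continuous_at_imp_continuous_on)
  note inc = increasing_branch[of f f' p c p q, OF deriv]
  note dec = decreasing_branch[of f f' d q q p, OF deriv]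
  interpret two_branch_horseshoe f "{p..q}" J
  proof
    show "closed (J i)" for i
    proof -
      have "closed ({u..v} \<inter> f -` {p..q})" for u v
        using cont[of UNIV] by (intro closed_Int) (auto simp: continuous_on_closed_vimage)
      then show ?thesis by (simp add: J_def Int_def vimage_def)
    qed
    show "J 1 \<inter> J 2 = {}" using ord by (auto simp: J_def)
    show "J 1 \<union> J 2 = {x \<in> {p..q}. f x \<in> {p..q}}"
    proof -
      have "x \<le> c \<or> d \<le> x" if "f x \<le> q" for x
        using middle[of x] that by force
      then show ?thesis using ord by (auto simp: J_def)
    qed
    fix i :: nat assume "i \<in> {1, 2}"
    then consider "i = 1" | "i = 2" by blast
    note i = this
    show "f ` J i = {p..q}"
      using i
    proof cases
      case 1
      have "f ` {x \<in> {p..c}. f x \<in> {p..q}} = {p..q}"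
        using ord ends middle[of c] pos expand by (intro inc(1)) auto
      then show ?thesis by (simp add: J_def 1)
    next
      case 2
      have "f ` {x \<in> {d..q}. f x \<in> {p..q}} = {p..q}"
        using ord ends middle[of d] neg expand by (intro dec(1)) auto
      then show ?thesis by (simp add: J_def 2)
    qed
    fix x y assume xy: "x \<in> J i" "y \<in> J i"
    show "2 * dist x y \<le> dist (f x) (f y)"
      using i
    proof cases
      case 1
      show ?thesis
        by (rule inc(2)) (use ord ends middle[of c] pos expand xy 1 in \<open>auto simp: J_def\<close>)
    next
      case 2
      show ?thesis
        by (rule dec(2)) (use ord ends middle[of d] neg expand xy 2 in \<open>auto simp: J_def\<close>)
    qed
  qed (use cont ord in auto)
  show inv: "invariant_set f \<Lambda>"
    unfolding invariant_set_def \<Lambda>_def by (rule image_Lam)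
  show "cantor_set \<Lambda>"
    unfolding cantor_set_def \<Lambda>_def
    using Lam_nonempty compact_Lam Lam_perfect Lam_connected_component by blast
  show "topologically_conjugate (top_of_set \<Lambda>) f Sigma2.mtopology shift"
    unfolding \<Lambda>_def by (rule conjugate_to_shift)
  have "2 ^ n \<le> \<bar>deriv (f ^^ n) x\<bar>" if x: "x \<in> \<Lambda>" for x n
  proof -
    have "2 \<le> \<bar>f' ((f ^^ k) x)\<bar>" for k
    proof (rule expand)
      have "(f ^^ Suc k) x \<in> {p..q}" using x unfolding \<Lambda>_def Lam_def by blast
      then show "f ((f ^^ k) x) \<in> {p..q}" by simp
    qed (use x in \<open>auto simp: \<Lambda>_def Lam_def\<close>)
    then have "(\<Prod>k<n. 2) \<le> (\<Prod>k<n. \<bar>f' ((f ^^ k) x)\<bar>)" by (intro prod_mono) auto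
    then show ?thesis
      using DERIV_imp_deriv[OF iterate_has_derivative[OF deriv, of n x]] by (simp add: abs_prod)
  qed
  then have "\<exists>C>0. \<exists>l>1. \<forall>x\<in>\<Lambda>. \<forall>n\<ge>1. \<bar>deriv (f ^^ n) x\<bar> \<ge> C * l ^ n"
    by (intro exI[of _ 1] exI[of _ 2] conjI) auto
  moreover have "deriv f = f'" using deriv by (auto intro: DERIV_imp_deriv)
  ultimately show "hyperbolic_on f \<Lambda>"
    unfolding hyperbolic_on_def
    using inv compact_Lam cont' deriv by (auto simp: \<Lambda>_def real_differentiable_def)
qed

section \<open>Polynomials near a root\<close>

lemma pderiv_root_factor:
  fixes h :: "real poly"
  shows "pderiv ([:- z, 1:] ^ Suc k * h)
    = [:- z, 1:] ^ k * (smult (of_nat (Suc k)) h + [:- z, 1:] * pderiv h)"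
proof -
  define L where "L = [:- z, 1:]"
  have "pderiv L = 1" by (simp add: L_def pderiv_pCons)
  then have "pderiv (L ^ Suc k) = smult (of_nat (Suc k)) (L ^ k)"
    by (simp only: pderiv_power_Suc mult_1_right)
  then have "pderiv (L ^ Suc k * h) = L ^ k * (smult (of_nat (Suc k)) h + L * pderiv h)"
    by (simp only: pderiv_mult) (simp add: algebra_simps)
  then show ?thesis by (simp only: L_def)
qed

text \<open>Each differentiation strips one factor and multiplies the value of the cofactor at the root by
  the current exponent.\<close>

lemma poly_higher_pderiv_root_factor:
  fixes h :: "real poly"
  shows "poly ((pderiv ^^ k) ([:- z, 1:] ^ k * h)) z = fact k * poly h z"
proof (induction k arbitrary: h)
  case (Suc k)
  show ?case
    by (simp only: funpow_Suc_right o_apply pderiv_root_factor Suc.IH) (simp add: algebra_simps)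
qed simp

lemma deriv_funpow_fam: "(deriv ^^ k) (fam g a) = (\<lambda>x. a * poly ((pderiv ^^ k) g) x)"
proof (induction k)
  case (Suc k)
  have "deriv (\<lambda>x. a * poly G x) = (\<lambda>x. a * poly (pderiv G) x)" for G
    by (rule ext, rule DERIV_imp_deriv) (auto intro!: derivative_eq_intros)
  then show ?case using Suc by simp
qed (simp add: fam_def fun_eq_iff)

lemma poly_root_factor:
  fixes g :: "real poly"
  assumes "g \<noteq> 0"
  obtains h where "g = [:- z, 1:] ^ order z g * h" "poly h z \<noteq> 0"
  using order_decomp[OF assms, of z] by (metis poly_eq_0_iff_dvd)

text \<open>After cancelling the factor \<open>(x - z) ^ m\<close>, the expression \<open>(x - z) g' / g\<close> becomes
  \<open>m + (x - z) h' / h\<close>, which is continuous at \<open>z\<close> with value the multiplicity \<open>m \<ge> 1\<close>; any constant below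
  \<open>1\<close> is a lower bound nearby.\<close>

lemma log_derivative_near_root:
  fixes g :: "real poly"
  assumes "g \<noteq> 0" "poly g z = 0"
  shows "\<exists>\<delta>>0. \<forall>x. 0 < \<bar>x - z\<bar> \<and> \<bar>x - z\<bar> < \<delta> \<longrightarrow> 1 / 2 \<le> (x - z) * poly (pderiv g) x / poly g x"
proof -
  obtain h where h: "g = [:- z, 1:] ^ order z g * h" "poly h z \<noteq> 0"
    using poly_root_factor[OF assms(1)] .
  obtain k where k: "order z g = Suc k"
    using assms order_root[of g z] not0_implies_Suc by blast
  define R where "R x = (real (Suc k) * poly h x + (x - z) * poly (pderiv h) x) / poly h x" for x
  have g: "g = [:- z, 1:] ^ Suc k * h" using h(1) k by simp
  have R: "(x - z) * poly (pderiv g) x / poly g x = R x" if "x \<noteq> z" for x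
  proof -
    have "(x - z) * poly (pderiv g) x
        = (x - z) ^ Suc k * (real (Suc k) * poly h x + (x - z) * poly (pderiv h) x)"
      unfolding g pderiv_root_factor by (simp add: algebra_simps)
    moreover have "poly g x = (x - z) ^ Suc k * poly h x" unfolding g by (simp add: algebra_simps)
    ultimately show ?thesis using that by (simp add: R_def del: power_Suc)
  qed
  have "isCont R z" unfolding R_def using h(2) by (intro continuous_intros) auto
  moreover have "R z = real (Suc k)" using h(2) by (simp add: R_def)
  ultimately have "(R \<longlongrightarrow> real (Suc k)) (at z)" by (simp add: isCont_def)
  then have "eventually (\<lambda>x. 1 / 2 < R x) (at z)" by (rule order_tendstoD) simp
  then obtain \<delta> where "\<delta> > 0" "\<And>x. x \<noteq> z \<Longrightarrow> dist x z < \<delta> \<Longrightarrow> 1 / 2 < R x"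
    unfolding eventually_at by auto
  then show ?thesis
    using R by (intro exI[of _ \<delta>]) (auto simp: dist_real_def less_imp_le)
qed

text \<open>With \<open>g = (x - p) ^ m h\<close>, the derivative of order \<open>m\<close> at \<open>p\<close> is \<open>m! a h(p)\<close>. So the hypothesis makes \<open>a h\<close>
  positive near \<open>p\<close>, and a change of sign further right would produce a root.\<close>

lemma fam_pos_right_of_root:
  assumes "g \<noteq> 0" "(deriv ^^ order p g) (fam g a) p > 0" "p < q"
    and no_root: "\<And>x. p < x \<Longrightarrow> x < q \<Longrightarrow> poly g x \<noteq> 0"
    and x: "p < x" "x < q"
  shows "fam g a x > 0"
proof (rule ccontr)
  assume "\<not> fam g a x > 0"
  obtain h where h: "g = [:- p, 1:] ^ order p g * h" "poly h p \<noteq> 0"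
    using poly_root_factor[OF assms(1)] .
  have "(deriv ^^ order p g) (fam g a) p = a * (fact (order p g) * poly h p)"
    unfolding deriv_funpow_fam using poly_higher_pderiv_root_factor[of "order p g" p h] h(1) by simp
  then have ah: "a * poly h p > 0"
    using assms(2) by (simp add: zero_less_mult_iff mult.left_commute[of a])
  have "((\<lambda>y. a * poly h y) \<longlongrightarrow> a * poly h p) (at_right p)"
    by (intro tendsto_intros)
  then have "eventually (\<lambda>y. a * poly h y > 0) (at_right p)"
    using ah by (rule order_tendstoD)
  moreover have "eventually (\<lambda>y. y \<in> {p<..<x}) (at_right p)"
    using x(1) by (rule eventually_at_right_real)
  ultimately have "eventually (\<lambda>y. a * poly h y > 0 \<and> y \<in> {p<..<x}) (at_right p)"
    by (rule eventually_conj)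
  then obtain y where y: "a * poly h y > 0" "p < y" "y < x"
    using eventually_happens[of _ "at_right p"] by auto
  have "poly g y = (y - p) ^ order p g * poly h y" by (subst h(1)) simp
  then have "fam g a y = (y - p) ^ order p g * (a * poly h y)"
    by (simp add: fam_def)
  then have "fam g a y > 0" using y by simp
  moreover have "continuous_on {y..x} (fam g a)" unfolding fam_def by (intro continuous_intros)
  ultimately obtain w where w: "y \<le> w" "w \<le> x" "fam g a w = 0"
    using IVT2'[of "fam g a" x 0 y] y \<open>\<not> fam g a x > 0\<close> by auto
  moreover have "a \<noteq> 0" using ah by auto
  ultimately show False using no_root[of w] x y by (auto simp: fam_def)
qed

text \<open>All constants depend on \<open>g\<close> and the two roots only, so the neighbourhoods on which \<open>f\<close> will
  expand are fixed before the parameter \<open>a\<close> is chosen.\<close>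

lemma large_log_derivative_near_consecutive_roots:
  fixes g :: "real poly"
  assumes "g \<noteq> 0" "0 < p" "p < q" and root: "poly g p = 0" "poly g q = 0"
    and no_root: "\<And>x. p < x \<Longrightarrow> x < q \<Longrightarrow> poly g x \<noteq> 0"
  obtains N c d where "N > 0" "p < c" "c < d" "d < q"
    "\<And>x. p < x \<Longrightarrow> x < c \<Longrightarrow> 2 / p \<le> poly (pderiv g) x / poly g x"
    "\<And>x. d < x \<Longrightarrow> x < q \<Longrightarrow> poly (pderiv g) x / poly g x \<le> - (2 / p)"
    "\<And>x. c \<le> x \<Longrightarrow> x \<le> d \<Longrightarrow> q < N * \<bar>poly g x\<bar>"
proof -
  let ?L = "\<lambda>x. poly (pderiv g) x / poly g x"
  obtain \<delta>1 where d1: "\<delta>1 > 0"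
    "\<And>x. 0 < \<bar>x - p\<bar> \<Longrightarrow> \<bar>x - p\<bar> < \<delta>1 \<Longrightarrow> 1 / 2 \<le> (x - p) * poly (pderiv g) x / poly g x"
    using log_derivative_near_root[OF assms(1) root(1)] by blast
  obtain \<delta>2 where d2: "\<delta>2 > 0"
    "\<And>x. 0 < \<bar>x - q\<bar> \<Longrightarrow> \<bar>x - q\<bar> < \<delta>2 \<Longrightarrow> 1 / 2 \<le> (x - q) * poly (pderiv g) x / poly g x"
    using log_derivative_near_root[OF assms(1) root(2)] by blast
  \<comment> \<open>Within \<open>p / 4\<close> of a root, the bound \<open>1 / 2 \<le> t * L\<close> forces \<open>L \<ge> 2 / p\<close>; the last entry gives \<open>c < d\<close>.\<close>
  define \<eta> where "\<eta> = min (min \<delta>1 \<delta>2) (min (p / 4) ((q - p) / 3))"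
  have \<eta>: "0 < \<eta>" "\<eta> \<le> \<delta>1" "\<eta> \<le> \<delta>2" "\<eta> \<le> p / 4" "\<eta> \<le> (q - p) / 3"
    using d1(1) d2(1) assms(2,3) unfolding \<eta>_def by (auto simp: min_def)
  have large: "2 / p \<le> L" if "0 < t" "t < \<eta>" "1 / 2 \<le> t * L" for t L
  proof -
    have "L > 0" using that zero_less_mult_pos[of t L] by linarith
    then have "t * L \<le> p / 4 * L" using that \<eta>(4) by (intro mult_right_mono) auto
    then show ?thesis using that(3) assms(2) by (simp add: field_simps)
  qed
  define c d where "c = p + \<eta>" and "d = q - \<eta>"
  have cd: "p < c" "c < d" "d < q" using \<eta> assms(3) by (auto simp: c_def d_def)
  have "continuous_on {c..d} (\<lambda>x. \<bar>poly g x\<bar>)" by (intro continuous_intros)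
  then obtain w where w: "w \<in> {c..d}" "\<And>x. x \<in> {c..d} \<Longrightarrow> \<bar>poly g w\<bar> \<le> \<bar>poly g x\<bar>"
    using continuous_attains_inf[of "{c..d}" "\<lambda>x. \<bar>poly g x\<bar>"] cd by auto
  have \<mu>: "\<bar>poly g w\<bar> > 0" using w(1) cd no_root[of w] by auto
  \<comment> \<open>The factor \<open>2\<close> makes the bound strict at the minimizer \<open>w\<close>.\<close>
  define N where "N = 2 * q / \<bar>poly g w\<bar>"
  show ?thesis
  proof (rule that[of N c d])
    show "N > 0" using \<mu> assms(2,3) by (simp add: N_def)
    show "2 / p \<le> ?L x" if "p < x" "x < c" for x
      using that d1(2)[of x] \<eta> by (intro large[of "x - p"]) (auto simp: c_def)
    show "?L x \<le> - (2 / p)" if "d < x" "x < q" for x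
    proof -
      have "1 / 2 \<le> (x - q) * poly (pderiv g) x / poly g x"
        using that \<eta> by (intro d2(2)) (auto simp: d_def)
      also have "\<dots> = (q - x) * (- ?L x)" by (simp add: algebra_simps diff_divide_distrib)
      finally have "2 / p \<le> - ?L x" using that by (intro large[of "q - x"]) (auto simp: d_def)
      then show ?thesis by linarith
    qed
    show "q < N * \<bar>poly g x\<bar>" if "c \<le> x" "x \<le> d" for x
    proof -
      have "q < 2 * q" using assms(2,3) by simp
      also have "\<dots> = N * \<bar>poly g w\<bar>" using \<mu> by (simp add: N_def)
      also have "\<dots> \<le> N * \<bar>poly g x\<bar>"
        using w(2)[of x] that \<mu> assms(2,3) by (intro mult_left_mono) (auto simp: N_def)
      finally show ?thesis .
    qed
  qed (use cd in auto)
qed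

theorem theorem3p1:
  fixes g :: "real poly" and r i0 :: nat and \<alpha> :: "nat \<Rightarrow> real" and m :: "nat \<Rightarrow> nat"
  assumes "lead_coeff g = 1"
    and "r \<ge> 2"
    and "strict_mono_on {1..r} \<alpha>"
    and "\<alpha> ` {1..r} = {x. poly g x = 0}"
    and "\<And>i. i \<in> {1..r} \<Longrightarrow> m i = order (\<alpha> i) g"
    and "1 \<le> i0" and "i0 < r"
    and "\<alpha> i0 > 0"
  shows "\<exists>N::real. N > 0 \<and> (\<forall>a::real. \<bar>a\<bar> > N \<longrightarrow> (deriv ^^ m i0) (fam g a) (\<alpha> i0) > 0 \<longrightarrow>
    (let f = fam g a; \<Lambda> = Lam f {\<alpha> i0 .. \<alpha> (i0 + 1)} in
      invariant_set f \<Lambda> \<and> cantor_set \<Lambda> \<and>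
      hyperbolic_on f \<Lambda> \<and>
      topologically_conjugate (top_of_set \<Lambda>) f (Metric_space.mtopology Sigma2 dist2) shift))"
proof -
  define p q where "p = \<alpha> i0" and "q = \<alpha> (i0 + 1)"
  have g0: "g \<noteq> 0" using assms(1) by auto
  have idx: "i0 \<in> {1..r}" "i0 + 1 \<in> {1..r}" using assms(6,7) by auto
  have p0: "0 < p" using assms(8) by (simp add: p_def)
  have pq: "p < q" using strict_mono_onD[OF assms(3) idx] by (simp add: p_def q_def)
  have root: "poly g p = 0" "poly g q = 0" using assms(4) idx by (auto simp: p_def q_def)
  have no_root: "poly g x \<noteq> 0" if "p < x" "x < q" for x
  proof
    assume "poly g x = 0"
    then obtain j where j: "j \<in> {1..r}" "x = \<alpha> j" using assms(4) by blast
    have "i0 < j" "j < i0 + 1"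
      using that strict_mono_on_less[OF assms(3)] idx j by (auto simp: p_def q_def)
    then show False by simp
  qed
  obtain N c d where N: "N > 0" and ord: "p < c" "c < d" "d < q"
    and left: "\<And>x. p < x \<Longrightarrow> x < c \<Longrightarrow> 2 / p \<le> poly (pderiv g) x / poly g x"
    and right: "\<And>x. d < x \<Longrightarrow> x < q \<Longrightarrow> poly (pderiv g) x / poly g x \<le> - (2 / p)"
    and middle: "\<And>x. c \<le> x \<Longrightarrow> x \<le> d \<Longrightarrow> q < N * \<bar>poly g x\<bar>"
    using large_log_derivative_near_consecutive_roots[OF g0 p0 pq root no_root] by blast
  have "invariant_set (fam g a) (Lam (fam g a) {p..q}) \<and> cantor_set (Lam (fam g a) {p..q}) \<and>
      hyperbolic_on (fam g a) (Lam (fam g a) {p..q}) \<and>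
      topologically_conjugate (top_of_set (Lam (fam g a) {p..q})) (fam g a) Sigma2.mtopology shift"
    if a: "\<bar>a\<bar> > N" and sgn: "(deriv ^^ m i0) (fam g a) p > 0" for a
  proof -
    let ?f = "fam g a" and ?f' = "\<lambda>x. a * poly (pderiv g) x"
    have f_pos: "?f x > 0" if "p < x" "x < q" for x
      using fam_pos_right_of_root[OF g0 _ pq no_root that] sgn assms(5)[OF idx(1)]
      by (simp add: p_def)
    have f'_eq: "?f' x = ?f x * (poly (pderiv g) x / poly g x)" if "p < x" "x < q" for x
      using no_root[OF that] by (simp add: fam_def)
    have deriv_left: "?f x * (2 / p) \<le> ?f' x" if "p < x" "x < c" for x
      using that ord f_pos[of x] left[of x] f'_eq[of x]
        mult_left_mono[of "2 / p" "poly (pderiv g) x / poly g x" "?f x"] by simp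
    have deriv_right: "?f' x \<le> ?f x * - (2 / p)" if "d < x" "x < q" for x
      using that ord f_pos[of x] right[of x] f'_eq[of x]
        mult_left_mono[of "poly (pderiv g) x / poly g x" "- (2 / p)" "?f x"] by simp
    have f_middle: "q < ?f x" if "c \<le> x" "x \<le> d" for x
    proof -
      have "q < N * \<bar>poly g x\<bar>" using middle that by blast
      also have "\<dots> \<le> \<bar>a\<bar> * \<bar>poly g x\<bar>" using a by (intro mult_right_mono) auto
      also have "\<dots> = ?f x" using f_pos[of x] that ord by (simp add: fam_def abs_mult[symmetric])
      finally show ?thesis .
    qed
    have two: "2 \<le> ?f x * (2 / p)" if "p \<le> ?f x" for x
      using that p0 by (simp add: field_simps)
    have f_ends: "?f p = 0" "?f q = 0" using root by (auto simp: fam_def)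
    have "2 \<le> \<bar>?f' x\<bar>" if x: "x \<in> {p..q}" "?f x \<in> {p..q}" for x
    proof -
      have "x \<noteq> p" "x \<noteq> q" using x(2) f_ends p0 by auto
      moreover have "\<not> (c \<le> x \<and> x \<le> d)" using f_middle[of x] x(2) by auto
      ultimately have "p < x \<and> x < c \<or> d < x \<and> x < q" using x(1) by auto
      then show ?thesis using two[of x] x(2) deriv_left[of x] deriv_right[of x] by auto
    qed
    moreover have "?f' x > 0" if "p < x" "x < c" for x
    proof -
      have "0 < ?f x * (2 / p)" using f_pos[of x] that ord p0 by simp
      then show ?thesis using deriv_left[OF that] by linarith
    qed
    moreover have "?f' x < 0" if "d < x" "x < q" for x
    proof -
      have "0 < ?f x * (2 / p)" using f_pos[of x] that ord p0 by simp
      then show ?thesis using deriv_right[OF that] by simp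
    qed
    moreover have "(?f has_real_derivative ?f' x) (at x)" for x
      unfolding fam_def by (auto intro!: derivative_eq_intros)
    moreover have "continuous_on UNIV ?f'" by (intro continuous_intros)
    moreover have "?f p \<le> p" "?f q \<le> p" using f_ends p0 by auto
    ultimately show ?thesis
      using unimodal_horseshoe[of ?f ?f' p c d q] ord f_middle by blast
  qed
  then show ?thesis
    using N unfolding p_def q_def Let_def by blast
qed

end
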